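(* Let $m,n$ be positive integers and let $f:\mathbb{R}^{m\times n}\to\mathbb{R}$ be a polynomial. If $f$ is lifted SOS polyconvex, then $f$ is SOS polyconvex; and if $f$ is SOS polyconvex, then $f$ is polyconvex.
   Context: Let $N=\sum_{s=1}^{\min(m,n)}\binom{m}{s}\binom{n}{s}$ and let $p:\mathbb{R}^{m\times n}\to\mathbb{R}^N$ map a matrix $X$ to the list (in some fixed order) of all its minors of orders $1,\dots,\min(m,n)$. A polynomial is SOS if it is a finite sum of squares of real polynomials. A polynomial $g:\mathbb{R}^N\to\mathbb{R}$ is SOS convex if $\langle y,\nabla^2 g(x)y\rangle$ is an SOS polynomial in the $2N$ variables $(x,y)$. A function $f:\mathbb{R}^{m\times n}\to\mathbb{R}\cup\{+\infty\}$ is polyconvex if there is a convex function $g:\mathbb{R}^N\to\mathbb{R}\cup\{+\infty\}$ with $f=g\circ p$. A polynomial $f:\mathbb{R}^{m\times n}\to\mathbb{R}$ is lifted SOS polyconvex if there is an SOS-convex polynomial $g:\mathbb{R}^N\to\mathbb{R}$ with $f=g\circ p$. A polynomial $f:\mathbb{R}^{m\times n}\to\mathbb{R}$ is SOS polyconvex if there is a polynomial map $q:\mathbb{R}^{m\times n}\to\mathbb{R}^N$ such that $f(X)-f(Y)-\langle q(Y),p(X)-p(Y)\rangle$ is an SOS polynomial in the entries of $X$ and $Y$. *)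

theory Defs
  imports "Jordan_Normal_Form.Determinant" "HOL-Analysis.Analysis"
begin

no_notation Matrix.vec_index (infixl \<open>$\<close> 100)
no_notation Matrix.scalar_prod (infix \<open>\<bullet>\<close> 70)

text \<open>
  A real matrix with \<open>m\<close> rows and \<open>n\<close> columns is an element of \<open>real ^ 'n ^ 'm\<close>; the orders on
  \<open>'m\<close> and \<open>'n\<close> are the orders of the rows and of the columns. The coordinates of the lifted space
  are named by the pairs \<open>(I, J)\<close> of a row set and a column set of the same positive size
  instead of being numbered from \<open>1\<close> to \<open>N\<close>.
\<close>

typedef ('m, 'n) minor_index =
  "{(I :: 'm::finite set, J :: 'n::finite set). I \<noteq> {} \<and> card I = card J}"
  morphisms minor_sets Abs_minor_index
  by (rule exI[of _ "({undefined}, {undefined})"]) simp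

instance minor_index :: (finite, finite) finite
proof
  have "range (minor_sets :: ('a, 'b) minor_index \<Rightarrow> _) \<subseteq> UNIV" by simp
  then have "finite (range (minor_sets :: ('a, 'b) minor_index \<Rightarrow> _))"
    by (rule finite_subset) simp
  moreover have "inj (minor_sets :: ('a, 'b) minor_index \<Rightarrow> _)"
    by (auto intro: injI simp: minor_sets_inject)
  ultimately show "finite (UNIV :: ('a, 'b) minor_index set)"
    by (rule finite_imageD)
qed

lemma CARD_minor_index:
  "CARD(('m::finite, 'n::finite) minor_index)
    = (\<Sum>s = 1..min CARD('m) CARD('n). (CARD('m) choose s) * (CARD('n) choose s))"
proof -
  let ?R = "\<lambda>s. {I :: 'm set. card I = s}" and ?C = "\<lambda>s. {J :: 'n set. card J = s}"
  let ?S = "{1..min CARD('m) CARD('n)}"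
  let ?A = "{(I :: 'm set, J :: 'n set). I \<noteq> {} \<and> card I = card J}"
  have "CARD(('m, 'n) minor_index) = card ?A"
    by (rule type_definition.card[OF type_definition_minor_index])
  also have "?A = (\<Union>s\<in>?S. ?R s \<times> ?C s)"
  proof (intro Set.set_eqI iffI)
    fix x assume "x \<in> ?A"
    then obtain I J where x: "x = (I, J)" "I \<noteq> {}" "card I = card J" by auto
    have "card I \<le> CARD('m)" "card J \<le> CARD('n)" by (simp_all add: card_mono)
    moreover have "1 \<le> card I" using x(2) by (simp add: Suc_le_eq card_gt_0_iff)
    ultimately have "card I \<in> ?S" using x(3) by simp
    then show "x \<in> (\<Union>s\<in>?S. ?R s \<times> ?C s)" using x by auto
  qed auto
  also have "card \<dots> = (\<Sum>s\<in>?S. card (?R s \<times> ?C s))"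
    by (rule card_UN_disjoint) auto
  also have "\<dots> = (\<Sum>s\<in>?S. (CARD('m) choose s) * (CARD('n) choose s))"
    using n_subsets[of "UNIV :: 'm set"] n_subsets[of "UNIV :: 'n set"]
    by (simp add: card_cartesian_product)
  finally show ?thesis .
qed

text \<open>
  The Jordan_Normal_Form determinant is used, since the order of a minor varies while the
  determinant of HOL-Analysis is tied to a fixed index type.
\<close>

definition minor ::
    "real ^ 'n::{finite,linorder} ^ 'm::{finite,linorder} \<Rightarrow> 'm set \<Rightarrow> 'n set \<Rightarrow> real" where
  "minor X I J = Determinant.det (Matrix.mat (card I) (card J)
     (\<lambda>(i, j). X $ (sorted_list_of_set I ! i) $ (sorted_list_of_set J ! j)))"

definition minors ::
    "real ^ 'n::{finite,linorder} ^ 'm::{finite,linorder} \<Rightarrow> real ^ ('m, 'n) minor_index" where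
  "minors X = (\<chi> k. case minor_sets k of (I, J) \<Rightarrow> minor X I J)"

definition sos :: "('a::real_normed_vector \<Rightarrow> real) \<Rightarrow> bool" where
  "sos f \<longleftrightarrow> (\<exists>hs. (\<forall>h\<in>set hs. real_polynomial_function h) \<and>
                  (\<forall>x. f x = (\<Sum>h\<leftarrow>hs. (h x)\<^sup>2)))"

definition gradient :: "(real ^ 'k \<Rightarrow> real) \<Rightarrow> real ^ 'k \<Rightarrow> real ^ 'k::finite" where
  "gradient g x = (\<chi> i. frechet_derivative g (at x) (axis i 1))"

definition hessian :: "(real ^ 'k \<Rightarrow> real) \<Rightarrow> real ^ 'k \<Rightarrow> real ^ 'k ^ 'k::finite" where
  "hessian g x = jacobian (gradient g) (at x)"

definition sos_convex :: "(real ^ 'k::finite \<Rightarrow> real) \<Rightarrow> bool" where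
  "sos_convex g \<longleftrightarrow> real_polynomial_function g \<and> sos (\<lambda>(x, y). y \<bullet> (hessian g x *v y))"

text \<open>
  Convexity of a function with values in \<open>\<real> \<union> {+\<infinity>}\<close>; in \<open>ereal\<close>, \<open>0 * \<infinity> = 0\<close>.
\<close>

definition convex_extended :: "('a::real_vector \<Rightarrow> ereal) \<Rightarrow> bool" where
  "convex_extended g \<longleftrightarrow> (\<forall>x. g x \<noteq> -\<infinity>) \<and>
     (\<forall>x y u v. 0 \<le> u \<longrightarrow> 0 \<le> v \<longrightarrow> u + v = 1 \<longrightarrow>
        g (u *\<^sub>R x + v *\<^sub>R y) \<le> ereal u * g x + ereal v * g y)"

definition polyconvex :: "(real ^ 'n::{finite,linorder} ^ 'm::{finite,linorder} \<Rightarrow> ereal) \<Rightarrow> bool" where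
  "polyconvex f \<longleftrightarrow> (\<exists>g. convex_extended g \<and> f = g \<circ> minors)"

definition lifted_sos_polyconvex ::
    "(real ^ 'n::{finite,linorder} ^ 'm::{finite,linorder} \<Rightarrow> real) \<Rightarrow> bool" where
  "lifted_sos_polyconvex f \<longleftrightarrow> (\<exists>g. sos_convex g \<and> f = g \<circ> minors)"

definition sos_polyconvex ::
    "(real ^ 'n::{finite,linorder} ^ 'm::{finite,linorder} \<Rightarrow> real) \<Rightarrow> bool" where
  "sos_polyconvex f \<longleftrightarrow> (\<exists>q. polynomial_function q \<and>
     sos (\<lambda>(X, Y). f X - f Y - q Y \<bullet> (minors X - minors Y)))"

end

theory Submission
  imports Defs
begin

text \<open>
  If \<open>g\<close> is SOS-convex, Taylor's formula with integral remainder expresses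
  \<open>g x - g y - \<nabla>g y \<bullet> (x - y)\<close> as the integral over \<open>t \<in> [0, 1]\<close> of \<open>1 - t\<close> times the Hessian
  form at \<open>y + t (x - y)\<close> in direction \<open>x - y\<close>, that is, of sums of squares of polynomials. Expanding
  each polynomial in powers of \<open>t\<close> turns such an integral into a quadratic form in the coefficients
  whose matrix is the positive semidefinite moment matrix of the weight \<open>1 - t\<close>; completing squares
  makes it SOS. Substituting minors gives SOS polyconvexity with \<open>q = \<nabla>g \<circ> minors\<close>. Conversely, an
  SOS polyconvex \<open>f\<close> is the restriction to the minors of the supremum of the affine functions
  \<open>x \<mapsto> f Y + q Y \<bullet> (x - minors Y)\<close>.
\<close>

section \<open>Positive semidefinite quadratic forms\<close>

text \<open>Induction on the dimension: completing the square in the last variable leaves the Schur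
  complement, which is again positive semidefinite. The rows of \<open>L\<close> are those of a
  Cholesky-type factor.\<close>

lemma psd_quadratic_form_sum_squares:
  fixes M :: "nat \<Rightarrow> nat \<Rightarrow> real"
  assumes "\<And>i j. M i j = M j i"
    and "\<And>c. 0 \<le> (\<Sum>i<d. \<Sum>j<d. M i j * c i * c j)"
  shows "\<exists>L. \<forall>c. (\<Sum>i<d. \<Sum>j<d. M i j * c i * c j) = (\<Sum>k<d. (\<Sum>j<d. L k j * c j)\<^sup>2)"
  using assms
proof (induction d arbitrary: M)
  case 0
  then show ?case by simp
next
  case (Suc d)
  define Q where "Q c = (\<Sum>i<d. \<Sum>j<d. M i j * c i * c j)" for c
  define l where "l c = (\<Sum>j<d. M d j * c j)" for c
  define m where "m = M d d"
  have split: "(\<Sum>i<Suc d. \<Sum>j<Suc d. M i j * c i * c j) = Q c + 2 * c d * l c + m * (c d)\<^sup>2" for c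
  proof -
    have "(\<Sum>i<d. M i d * c i * c d) = c d * l c" "(\<Sum>j<d. M d j * c d * c j) = c d * l c"
      unfolding l_def sum_distrib_left
      by (intro sum.cong refl; use Suc.prems(1)[of _ d] in \<open>metis mult.assoc mult.commute\<close>)+
    then show ?thesis
      by (simp add: Q_def m_def sum.distrib power2_eq_square)
  qed
  \<comment> \<open>\<open>Q\<close> and \<open>l\<close> ignore the last coordinate, so it can be
    set to any \<open>t\<close>: the form is a nonnegative quadratic polynomial in
    \<open>t\<close>.\<close>
  have nonneg: "0 \<le> Q c + 2 * t * l c + m * t\<^sup>2" for c t
  proof -
    have "Q (c(d := t)) = Q c" "l (c(d := t)) = l c"
      by (simp_all add: Q_def l_def)
    then show ?thesis
      using Suc.prems(2)[of "c(d := t)"] unfolding split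
      by (simp del: fun_upd_apply add: fun_upd_same)
  qed
  have m: "0 \<le> m"
    using nonneg[of "\<lambda>_. 0" 1] by (simp add: Q_def l_def)
  have l0: "l c = 0" if "m = 0" for c
  proof (rule ccontr)
    assume "l c \<noteq> 0"
    \<comment> \<open>With \<open>m = 0\<close> the form is affine in \<open>t\<close>; a nonzero
      slope would let it reach the value -1, and this is the \<open>t\<close> that does so.\<close>
    then have "2 * (- (Q c + 1) / (2 * l c)) * l c = - (Q c + 1)" by (simp add: field_simps)
    then show False using nonneg[of c "- (Q c + 1) / (2 * l c)"] that by simp
  qed
  \<comment> \<open>For \<open>m = 0\<close> the identity survives because \<open>l c = 0\<close>
    and division by zero yields zero, so the degenerate pivot needs no separate treatment
    below.\<close>
  have square: "Q c + 2 * t * l c + m * t\<^sup>2 = (Q c - (l c)\<^sup>2 / m) + m * (t + l c / m)\<^sup>2" for c t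
    using l0[of c] by (cases "m = 0") (simp_all add: power2_eq_square field_simps)
  define M' where "M' i j = M i j - M d i * M d j / m" for i j
  have Q': "(\<Sum>i<d. \<Sum>j<d. M' i j * c i * c j) = Q c - (l c)\<^sup>2 / m" for c
  proof -
    have "(l c)\<^sup>2 / m = (\<Sum>i<d. \<Sum>j<d. M d i * M d j / m * c i * c j)"
      by (simp add: l_def power2_eq_square sum_product sum_divide_distrib mult_ac)
    then show ?thesis
      by (simp add: M'_def Q_def sum_subtractf[symmetric] left_diff_distrib)
  qed
  have "\<exists>L. \<forall>c. (\<Sum>i<d. \<Sum>j<d. M' i j * c i * c j) = (\<Sum>k<d. (\<Sum>j<d. L k j * c j)\<^sup>2)"
  proof (rule Suc.IH)
    show "M' i j = M' j i" for i j
      using Suc.prems(1)[of i j] by (simp add: M'_def mult.commute)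
    show "0 \<le> (\<Sum>i<d. \<Sum>j<d. M' i j * c i * c j)" for c
      \<comment> \<open>The minimizing \<open>t\<close>, at which the completed square
        vanishes.\<close>
      using nonneg[of c "- l c / m"] unfolding square Q' by simp
  qed
  then obtain L where L: "\<And>c. Q c - (l c)\<^sup>2 / m = (\<Sum>k<d. (\<Sum>j<d. L k j * c j)\<^sup>2)"
    unfolding Q' by blast
  \<comment> \<open>The rows of \<open>L\<close> padded by a zero in column \<open>d\<close>, and a
    new row for the form \<open>sqrt m * (c d + l c / m)\<close>.\<close>
  define L' where "L' k j = (if k < d then if j < d then L k j else 0
      else sqrt m * (if j < d then M d j / m else 1))" for k j
  have "(\<Sum>i<Suc d. \<Sum>j<Suc d. M i j * c i * c j) = (\<Sum>k<Suc d. (\<Sum>j<Suc d. L' k j * c j)\<^sup>2)" for c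
  proof -
    have "(\<Sum>j<Suc d. L' d j * c j) = sqrt m * (c d + l c / m)"
      by (simp add: L'_def l_def sum_distrib_left sum_divide_distrib algebra_simps)
    then have "(\<Sum>j<Suc d. L' d j * c j)\<^sup>2 = m * (c d + l c / m)\<^sup>2"
      using m by (simp only: power_mult_distrib real_sqrt_pow2)
    moreover have "(\<Sum>k<d. (\<Sum>j<Suc d. L' k j * c j)\<^sup>2) = (\<Sum>k<d. (\<Sum>j<d. L k j * c j)\<^sup>2)"
      by (intro sum.cong refl) (simp add: L'_def)
    ultimately show ?thesis
      unfolding split square L by (simp only: sum.lessThan_Suc)
  qed
  then show ?case by blast
qed

section \<open>Polynomial functions and sums of squares\<close>

text \<open>A linear functional on a product is the sum of its restrictions to the two factors, and
  each restriction composes with one component.\<close>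

lemma polynomial_function_Pair:
  assumes "polynomial_function f" "polynomial_function g"
  shows "polynomial_function (\<lambda>x. (f x, g x))"
  unfolding polynomial_function_def o_def
proof (intro allI impI)
  fix l :: "'b \<times> 'c \<Rightarrow> real"
  assume l: "bounded_linear l"
  have split: "l (a, b) = l (a, 0) + l (0, b)" for a b
    using linear_add[OF bounded_linear.linear[OF l], of "(a, 0)" "(0, b)"] by simp
  have "bounded_linear (\<lambda>a. l (a, 0))" "bounded_linear (\<lambda>b. l (0, b))"
    by (auto intro!: bounded_linear_compose[OF l] bounded_linear_Pair bounded_linear_ident
        bounded_linear_zero)
  then have "real_polynomial_function (\<lambda>x. l (f x, 0))" "real_polynomial_function (\<lambda>x. l (0, g x))"
    using assms unfolding polynomial_function_def o_def by blast+
  then have "real_polynomial_function (\<lambda>x. l (f x, 0) + l (0, g x))"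
    by (rule real_polynomial_function.intros(3))
  moreover have "(\<lambda>x. l (f x, 0) + l (0, g x)) = (\<lambda>x. l (f x, g x))"
    by (rule ext) (rule split[symmetric])
  ultimately show "real_polynomial_function (\<lambda>x. l (f x, g x))"
    by (rule subst[rotated])
qed

lemma polynomial_function_vec:
  fixes f :: "'a::real_normed_vector \<Rightarrow> real ^ 'k::finite"
  assumes "\<And>i. real_polynomial_function (\<lambda>x. f x $ i)"
  shows "polynomial_function f"
  using assms by (auto simp: polynomial_function_iff_Basis_inner Basis_vec_def inner_axis)

text \<open>The vanishing beyond \<open>d\<close> is what the library's product formula for power sums asks for.\<close>

lemma real_polynomial_function_line:
  fixes h :: "'b::real_normed_vector \<Rightarrow> real" and a b :: "'a::real_normed_vector \<Rightarrow> 'b"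
  assumes h: "real_polynomial_function h" and a: "polynomial_function a" and b: "polynomial_function b"
  shows "\<exists>d c. (\<forall>j. real_polynomial_function (c j)) \<and> (\<forall>j>d. \<forall>z. c j z = 0) \<and>
     (\<forall>z t. h (a z + t *\<^sub>R b z) = (\<Sum>j\<le>d. c j z * t ^ j))"
  using h
proof induction
  case (linear f)
  define c where "c j z = (if j = 0 then f (a z) else if j = 1 then f (b z) else 0)" for j :: nat and z
  have "real_polynomial_function (c j)" for j
    using a b linear unfolding c_def polynomial_function_def o_def
    by (cases "j = 0"; cases "j = 1") (auto intro: real_polynomial_function.intros(2))
  moreover have "f (a z + t *\<^sub>R b z) = (\<Sum>j\<le>1. c j z * t ^ j)" for z t
    using bounded_linear.linear[OF linear] by (simp add: c_def linear_add linear_scale)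
  moreover have "c j z = 0" if "j > 1" for j z
    using that by (simp add: c_def)
  ultimately show ?case by blast
next
  case (const k)
  show ?case
    by (intro exI[of _ 0] exI[of _ "\<lambda>j _. if j = 0 then k else 0"])
      (auto intro: real_polynomial_function.intros(2))
next
  case (add f g)
  obtain d c where
    c: "\<And>j. real_polynomial_function (c j)" "\<And>j z. j > d \<Longrightarrow> c j z = 0"
       "\<And>z t. f (a z + t *\<^sub>R b z) = (\<Sum>j\<le>d. c j z * t ^ j)"
    using add.IH(1) by blast
  obtain e c' where
    c': "\<And>j. real_polynomial_function (c' j)" "\<And>j z. j > e \<Longrightarrow> c' j z = 0"
       "\<And>z t. g (a z + t *\<^sub>R b z) = (\<Sum>j\<le>e. c' j z * t ^ j)"
    using add.IH(2) by blast
  \<comment> \<open>The vanishing coefficients pad both expansions to a common degree.\<close>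
  have "(\<Sum>j\<le>d. c j z * t ^ j) = (\<Sum>j\<le>max d e. c j z * t ^ j)"
    "(\<Sum>j\<le>e. c' j z * t ^ j) = (\<Sum>j\<le>max d e. c' j z * t ^ j)" for z t
    by (rule sum.mono_neutral_left; simp add: c(2) c'(2))+
  then have "f (a z + t *\<^sub>R b z) + g (a z + t *\<^sub>R b z)
      = (\<Sum>j\<le>max d e. (c j z + c' j z) * t ^ j)" for z t
    by (simp add: c(3) c'(3) sum.distrib distrib_right)
  then show ?case
    by (intro exI[of _ "max d e"] exI[of _ "\<lambda>j z. c j z + c' j z"])
      (auto intro: real_polynomial_function.intros(3) c(1) c'(1) simp: c(2) c'(2))
next
  case (mult f g)
  obtain d c where
    c: "\<And>j. real_polynomial_function (c j)" "\<And>j z. j > d \<Longrightarrow> c j z = 0"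
       "\<And>z t. f (a z + t *\<^sub>R b z) = (\<Sum>j\<le>d. c j z * t ^ j)"
    using mult.IH(1) by blast
  obtain e c' where
    c': "\<And>j. real_polynomial_function (c' j)" "\<And>j z. j > e \<Longrightarrow> c' j z = 0"
       "\<And>z t. g (a z + t *\<^sub>R b z) = (\<Sum>j\<le>e. c' j z * t ^ j)"
    using mult.IH(2) by blast
  \<comment> \<open>The Cauchy product of the two coefficient sequences.\<close>
  define c'' where "c'' r z = (\<Sum>k\<le>r. c k z * c' (r - k) z)" for r z
  have "f (a z + t *\<^sub>R b z) * g (a z + t *\<^sub>R b z) = (\<Sum>j\<le>d + e. c'' j z * t ^ j)" for z t
    unfolding c(3) c'(3) c''_def
    by (rule polynomial_product) (simp_all add: c(2) c'(2))
  moreover have "real_polynomial_function (c'' r)" for r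
    unfolding c''_def
    by (intro real_polynomial_function_sum real_polynomial_function.intros(4) c(1) c'(1)) auto
  moreover have "c'' r z = 0" if "r > d + e" for r z
    unfolding c''_def
  proof (rule sum.neutral, intro ballI)
    fix k assume "k \<in> {..r}"
    have "k > d \<or> r - k > e" using that by linarith
    then show "c k z * c' (r - k) z = 0" by (auto simp: c(2) c'(2))
  qed
  ultimately show ?case by blast
qed

text \<open>Structural induction with the direction \<open>v\<close> fixed: a linear function has a
  derivative constant in \<open>x\<close>, and the sum and product rules stay within
  polynomials.\<close>

lemma real_polynomial_function_frechet_derivative:
  assumes "real_polynomial_function g"
  shows "real_polynomial_function (\<lambda>x. frechet_derivative g (at x) v)"
  using assms
proof induction
  case (linear f)
  then have "frechet_derivative f (at x) = f" for x
    by (metis bounded_linear_imp_has_derivative frechet_derivative_at)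
  then show ?case by (simp add: real_polynomial_function.intros(2))
next
  case (const c)
  then show ?case by (simp add: real_polynomial_function.intros(2))
next
  case (add f g)
  have "frechet_derivative (\<lambda>x. f x + g x) (at x) v
      = frechet_derivative f (at x) v + frechet_derivative g (at x) v" for x
  proof -
    have "((\<lambda>x. f x + g x) has_derivative
        (\<lambda>v. frechet_derivative f (at x) v + frechet_derivative g (at x) v)) (at x)"
      using add.hyps by (intro has_derivative_add)
        (auto simp: frechet_derivative_works[symmetric] differentiable_at_real_polynomial_function)
    from frechet_derivative_at[OF this] show ?thesis by metis
  qed
  then show ?case using add.IH by (simp add: real_polynomial_function.intros(3))
next
  case (mult f g)
  have "frechet_derivative (\<lambda>x. f x * g x) (at x) v
      = f x * frechet_derivative g (at x) v + frechet_derivative f (at x) v * g x" for x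
  proof -
    have "((\<lambda>x. f x * g x) has_derivative
        (\<lambda>v. f x * frechet_derivative g (at x) v + frechet_derivative f (at x) v * g x)) (at x)"
      using mult.hyps by (intro has_derivative_mult)
        (auto simp: frechet_derivative_works[symmetric] differentiable_at_real_polynomial_function)
    from frechet_derivative_at[OF this] show ?thesis by metis
  qed
  then show ?case
    using mult by (auto intro!: real_polynomial_function.intros(3) real_polynomial_function.intros(4))
qed

section \<open>Closure properties of sums of squares\<close>

lemma sos_nonneg: "sos f \<Longrightarrow> 0 \<le> f x"
  unfolding sos_def by (auto intro!: sum_list_nonneg)

lemma sos_zero: "sos (\<lambda>x. 0)"
  unfolding sos_def by (intro exI[of _ "[]"]) simp

lemma sos_square: "real_polynomial_function h \<Longrightarrow> sos (\<lambda>x. (h x)\<^sup>2)"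
  unfolding sos_def by (intro exI[of _ "[h]"]) simp

lemma sos_add:
  assumes "sos f" "sos g"
  shows "sos (\<lambda>x. f x + g x)"
proof -
  obtain hs ks where "\<forall>h\<in>set hs. real_polynomial_function h" "\<forall>x. f x = (\<Sum>h\<leftarrow>hs. (h x)\<^sup>2)"
    "\<forall>h\<in>set ks. real_polynomial_function h" "\<forall>x. g x = (\<Sum>h\<leftarrow>ks. (h x)\<^sup>2)"
    using assms unfolding sos_def by blast
  then show ?thesis
    unfolding sos_def by (intro exI[of _ "hs @ ks"]) auto
qed

lemma sos_sum: "finite I \<Longrightarrow> (\<And>i. i \<in> I \<Longrightarrow> sos (f i)) \<Longrightarrow> sos (\<lambda>x. \<Sum>i\<in>I. f i x)"
  by (induction I rule: finite_induct) (auto intro: sos_zero sos_add)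

lemma sos_sum_list: "(\<And>h. h \<in> set hs \<Longrightarrow> sos (F h)) \<Longrightarrow> sos (\<lambda>x. \<Sum>h\<leftarrow>hs. F h x)"
  by (induction hs) (auto intro: sos_zero sos_add)

lemma sos_compose:
  assumes "sos f" "polynomial_function p"
  shows "sos (\<lambda>x. f (p x))"
proof -
  obtain hs where "\<forall>h\<in>set hs. real_polynomial_function h" "\<forall>x. f x = (\<Sum>h\<leftarrow>hs. (h x)\<^sup>2)"
    using assms(1) unfolding sos_def by blast
  then show ?thesis
    unfolding sos_def using real_polynomial_function_compose[OF assms(2)]
    by (intro exI[of _ "map (\<lambda>h. h \<circ> p) hs"]) (simp add: comp_def)
qed

text \<open>The moment matrix \<open>M\<close> depends on the weight and the interval but not on
  \<open>z\<close>. Hence a single \<open>L\<close> serves all \<open>z\<close>, and the squared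
  terms are fixed linear combinations of the polynomials \<open>c j\<close>.\<close>

lemma sos_integral_square:
  fixes h :: "'b::real_normed_vector \<Rightarrow> real" and a b :: "'a::real_normed_vector \<Rightarrow> 'b"
  assumes h: "real_polynomial_function h" and a: "polynomial_function a" and b: "polynomial_function b"
    and w: "continuous_on {u..v} w" "\<And>t. t \<in> {u..v} \<Longrightarrow> 0 \<le> w t"
  shows "sos (\<lambda>z. integral {u..v} (\<lambda>t. w t * (h (a z + t *\<^sub>R b z))\<^sup>2))"
proof -
  obtain d c where c: "\<And>j. real_polynomial_function (c j)"
    "\<And>z t. h (a z + t *\<^sub>R b z) = (\<Sum>j\<le>d. c j z * t ^ j)"
    using real_polynomial_function_line[OF h a b] by blast
  define M where "M i j = integral {u..v} (\<lambda>t. w t * t ^ (i + j))" for i j :: nat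
  \<comment> \<open>Stated for arbitrary real coefficients \<open>s\<close>, because positive
    semidefiniteness of \<open>M\<close> concerns all real vectors and not only those of the form
    \<open>c j z\<close>.\<close>
  have form: "integral {u..v} (\<lambda>t. w t * (\<Sum>j<Suc d. s j * t ^ j)\<^sup>2)
      = (\<Sum>i<Suc d. \<Sum>j<Suc d. M i j * s i * s j)" for s
  proof -
    have "((\<lambda>t. \<Sum>i<Suc d. \<Sum>j<Suc d. s i * s j * (w t * t ^ (i + j))) has_integral
        (\<Sum>i<Suc d. \<Sum>j<Suc d. s i * s j * M i j)) {u..v}"
      unfolding M_def
      by (intro has_integral_sum finite_lessThan has_integral_mult_right integrable_integral
          integrable_continuous_real continuous_intros w(1))
    moreover have "(\<Sum>i<Suc d. \<Sum>j<Suc d. s i * s j * (w t * t ^ (i + j)))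
        = w t * (\<Sum>j<Suc d. s j * t ^ j)\<^sup>2" for t
      by (simp only: power2_eq_square sum_product sum_distrib_left power_add mult_ac)
    ultimately show ?thesis
      by (simp only: integral_unique mult_ac)
  qed
  \<comment> \<open>Degrees 0 to \<open>d\<close> give \<open>Suc d\<close> coefficients, hence the
    dimension. Nonnegativity comes from reading the form as the integral of a nonnegative weight
    times a square.\<close>
  have "\<exists>L. \<forall>s. (\<Sum>i<Suc d. \<Sum>j<Suc d. M i j * s i * s j)
      = (\<Sum>k<Suc d. (\<Sum>j<Suc d. L k j * s j)\<^sup>2)"
  proof (rule psd_quadratic_form_sum_squares)
    show "M i j = M j i" for i j
      by (simp add: M_def add.commute)
    show "0 \<le> (\<Sum>i<Suc d. \<Sum>j<Suc d. M i j * s i * s j)" for s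
      unfolding form[symmetric]
      by (intro integral_nonneg integrable_continuous_real continuous_intros w mult_nonneg_nonneg) auto
  qed
  then obtain L where L: "\<And>s. (\<Sum>i<Suc d. \<Sum>j<Suc d. M i j * s i * s j)
      = (\<Sum>k<Suc d. (\<Sum>j<Suc d. L k j * s j)\<^sup>2)" by blast
  have "sos (\<lambda>z. \<Sum>k<Suc d. (\<Sum>j<Suc d. L k j * c j z)\<^sup>2)"
    by (intro sos_sum sos_square real_polynomial_function_sum real_polynomial_function.intros(4)
        real_polynomial_function.intros(2) c(1) finite_lessThan)
  moreover have "integral {u..v} (\<lambda>t. w t * (h (a z + t *\<^sub>R b z))\<^sup>2)
      = (\<Sum>k<Suc d. (\<Sum>j<Suc d. L k j * c j z)\<^sup>2)" for z
    unfolding c(2) lessThan_Suc_atMost[symmetric] form L ..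
  ultimately show ?thesis by simp
qed

section \<open>First-order characterization of SOS-convexity\<close>

text \<open>By linearity the derivative is determined by its values on the axes, which are the
  entries of \<open>gradient\<close>.\<close>

lemma has_derivative_gradient:
  fixes g :: "real ^ 'k::finite \<Rightarrow> real"
  assumes "g differentiable (at x)"
  shows "(g has_derivative (\<lambda>v. gradient g x \<bullet> v)) (at x)"
proof -
  let ?D = "frechet_derivative g (at x)"
  have D: "(g has_derivative ?D) (at x)"
    using assms by (simp add: frechet_derivative_works)
  then have lin: "linear ?D" by (rule has_derivative_linear)
  have "?D v = gradient g x \<bullet> v" for v
  proof -
    have "?D v = ?D (\<Sum>i\<in>UNIV. v $ i *\<^sub>R axis i 1)"
      using basis_expansion[of v] by (simp add: scalar_mult_eq_scaleR)
    also have "\<dots> = gradient g x \<bullet> v"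
      by (simp add: linear_sum[OF lin] linear_scale[OF lin] gradient_def inner_vec_def mult.commute)
    finally show ?thesis .
  qed
  then have "?D = (\<lambda>v. gradient g x \<bullet> v)" by (rule ext)
  with D show ?thesis by simp
qed

lemma polynomial_function_gradient:
  fixes g :: "real ^ 'k::finite \<Rightarrow> real"
  assumes "real_polynomial_function g"
  shows "polynomial_function (gradient g)"
  by (rule polynomial_function_vec)
    (simp add: gradient_def real_polynomial_function_frechet_derivative[OF assms])

lemma taylor_integral_hessian:
  fixes g :: "real ^ 'k::finite \<Rightarrow> real"
  assumes g: "real_polynomial_function g"
  shows "((\<lambda>t. (1 - t) * ((x - y) \<bullet> (hessian g (y + t *\<^sub>R (x - y)) *v (x - y)))) has_integral
      g x - g y - gradient g y \<bullet> (x - y)) {0..1}"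
proof -
  let ?v = "x - y" and ?l = "\<lambda>t::real. y + t *\<^sub>R (x - y)"
  have l: "(?l has_derivative (\<lambda>s. s *\<^sub>R ?v)) (at t within S)" for t S
    by (auto intro!: derivative_eq_intros)
  have "((\<lambda>t. g (?l t)) has_derivative (\<lambda>s. gradient g (?l t) \<bullet> (s *\<^sub>R ?v))) (at t within S)" for t S
    by (rule has_derivative_compose[OF l has_derivative_gradient])
      (rule differentiable_at_real_polynomial_function[OF g])
  then have d1: "((\<lambda>t. g (?l t)) has_real_derivative gradient g (?l t) \<bullet> ?v) (at t within S)" for t S
    by (simp add: has_field_derivative_def mult.commute[of "gradient g (?l t) \<bullet> ?v"] mult_commute_abs)
  \<comment> \<open>The gradient is a polynomial map, hence differentiable, and its Jacobian is the
    Hessian.\<close>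
  have "(gradient g has_derivative (\<lambda>v. hessian g z *v v)) (at z)" for z
    unfolding hessian_def jacobian_works[symmetric]
    by (rule differentiable_at_polynomial_function[OF polynomial_function_gradient[OF g]])
  then have "((\<lambda>t. gradient g (?l t)) has_derivative (\<lambda>s. hessian g (?l t) *v (s *\<^sub>R ?v))) (at t within S)" for t S
    by (rule has_derivative_compose[OF l])
  then have "((\<lambda>t. gradient g (?l t) \<bullet> ?v) has_derivative
      (\<lambda>s. (hessian g (?l t) *v (s *\<^sub>R ?v)) \<bullet> ?v)) (at t within S)" for t S
    by (rule has_derivative_inner_left)
  then have d2: "((\<lambda>t. gradient g (?l t) \<bullet> ?v) has_real_derivative
      ?v \<bullet> (hessian g (?l t) *v ?v)) (at t within S)" for t S
    by (simp add: has_field_derivative_def matrix_vector_mult_scaleR inner_commute mult_commute_abs)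
  \<comment> \<open>An explicit antiderivative replaces integration by parts: in its derivative the
    two first-order terms cancel. Its value is \<open>g x\<close> at \<open>t = 1\<close> and
    \<open>g y + gradient g y \<bullet> (x - y)\<close> at \<open>t = 0\<close>.\<close>
  have "((\<lambda>t. g (?l t) + (1 - t) * (gradient g (?l t) \<bullet> ?v)) has_vector_derivative
      (1 - t) * (?v \<bullet> (hessian g (?l t) *v ?v))) (at t within {0..1})" for t
    unfolding has_real_derivative_iff_has_vector_derivative[symmetric]
    by (auto intro!: derivative_eq_intros d1 d2)
  from fundamental_theorem_of_calculus[OF zero_le_one this] show ?thesis
    by (simp add: algebra_simps)
qed

lemma sos_convex_first_order:
  fixes g :: "real ^ 'k::finite \<Rightarrow> real"
  assumes "sos_convex g"
  shows "sos (\<lambda>(x, y). g x - g y - gradient g y \<bullet> (x - y))"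
proof -
  have g: "real_polynomial_function g" using assms by (simp add: sos_convex_def)
  obtain hs where hs: "\<And>h. h \<in> set hs \<Longrightarrow> real_polynomial_function h"
    "\<And>x y. y \<bullet> (hessian g x *v y) = (\<Sum>h\<leftarrow>hs. (h (x, y))\<^sup>2)"
    using assms unfolding sos_convex_def sos_def by fastforce
  \<comment> \<open>For \<open>z = (x, y)\<close>, the pair of base point
    \<open>y + t *\<^sub>R (x - y)\<close> and constant direction \<open>x - y\<close> is the line
    \<open>?a z + t *\<^sub>R ?b z\<close>.\<close>
  let ?a = "\<lambda>z :: (real ^ 'k) \<times> (real ^ 'k). (snd z, fst z - snd z)"
  let ?b = "\<lambda>z :: (real ^ 'k) \<times> (real ^ 'k). (fst z - snd z, 0 :: real ^ 'k)"
  let ?R = "\<lambda>h z. integral {0..1} (\<lambda>t::real. (1 - t) * (h (?a z + t *\<^sub>R ?b z))\<^sup>2)"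
  have ab: "polynomial_function ?a" "polynomial_function ?b"
    by (intro polynomial_function_Pair polynomial_function_diff polynomial_function_const
        polynomial_function_bounded_linear bounded_linear_fst bounded_linear_snd)+
  have "sos (\<lambda>z. \<Sum>h\<leftarrow>hs. ?R h z)"
    by (intro sos_sum_list sos_integral_square hs(1) ab continuous_intros) auto
  moreover have "g x - g y - gradient g y \<bullet> (x - y) = (\<Sum>h\<leftarrow>hs. ?R h (x, y))" for x y
  proof -
    have int: "((\<lambda>t. (1 - t) * (h (?a (x, y) + t *\<^sub>R ?b (x, y)))\<^sup>2) has_integral ?R h (x, y)) {0..1}"
      if "h \<in> set hs" for h
    proof (intro integrable_integral integrable_continuous_real continuous_intros)
      have "continuous_on UNIV h"
        using hs(1)[OF that] by (simp add: continuous_on_polymonial_function real_polynomial_function_eq)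
      then show "continuous_on {0..1} (\<lambda>t. h (?a (x, y) + t *\<^sub>R ?b (x, y)))"
        by (rule continuous_on_compose2) (auto intro!: continuous_intros)
    qed
    \<comment> \<open>The induction runs over lists with members in \<open>hs\<close>, since
      \<open>int\<close> holds only for these.\<close>
    have "((\<lambda>t. \<Sum>h\<leftarrow>hs'. (1 - t) * (h (?a (x, y) + t *\<^sub>R ?b (x, y)))\<^sup>2) has_integral
        (\<Sum>h\<leftarrow>hs'. ?R h (x, y))) {0..1}" if "set hs' \<subseteq> set hs" for hs'
      using that
    proof (induction hs')
      case (Cons h hs')
      then show ?case
        unfolding list.map sum_list.Cons by (intro has_integral_add int) auto
    qed simp
    then have "((\<lambda>t. \<Sum>h\<leftarrow>hs. (1 - t) * (h (?a (x, y) + t *\<^sub>R ?b (x, y)))\<^sup>2) has_integral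
        (\<Sum>h\<leftarrow>hs. ?R h (x, y))) {0..1}" by blast
    moreover have "(\<Sum>h\<leftarrow>hs. (1 - t) * (h (?a (x, y) + t *\<^sub>R ?b (x, y)))\<^sup>2)
        = (1 - t) * ((x - y) \<bullet> (hessian g (y + t *\<^sub>R (x - y)) *v (x - y)))" for t
      by (simp add: hs(2) sum_list_const_mult)
    \<comment> \<open>Both values are integrals of the same Hessian expression, so they
      agree.\<close>
    ultimately show ?thesis
      using taylor_integral_hessian[OF g, of x y] by (auto dest: has_integral_unique)
  qed
  ultimately show ?thesis by (simp add: case_prod_unfold)
qed

section \<open>Polyconvexity\<close>

lemma real_polynomial_function_minor:
  fixes I :: "'m::{finite,linorder} set" and J :: "'n::{finite,linorder} set"
  assumes "card I = card J"
  shows "real_polynomial_function (\<lambda>X. minor X I J)"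
proof -
  have entry: "real_polynomial_function (\<lambda>X :: real ^ 'n::{finite,linorder} ^ 'm::{finite,linorder}. X $ i $ j)" for i j
    by (intro real_polynomial_function.intros(1) bounded_linear_compose[OF bounded_linear_vec_nth]
        bounded_linear_vec_nth)
  \<comment> \<open>Equal cardinalities make the submatrix square, so its determinant is the Leibniz
    sum, visibly polynomial in the entries.\<close>
  have "minor X I J = (\<Sum>p | p permutes {0..<card J}. signof p *
      (\<Prod>i = 0..<card J. X $ (sorted_list_of_set I ! i) $ (sorted_list_of_set J ! p i)))" for X
    using assms
    by (auto simp: minor_def Determinant.det_def permutes_in_image intro!: sum.cong prod.cong)
  then show ?thesis
    by (auto intro!: real_polynomial_function_sum real_polynomial_function.intros(4)
        real_polynomial_function_prod real_polynomial_function.intros(2) entry finite_permutations)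
qed

lemma polynomial_function_minors:
  "polynomial_function (minors :: real ^ 'n::{finite,linorder} ^ 'm::{finite,linorder} \<Rightarrow> _)"
proof (rule polynomial_function_vec)
  fix k :: "('m::{finite,linorder}, 'n::{finite,linorder}) minor_index"
  obtain I J where "minor_sets k = (I, J)" "card I = card J"
    using minor_sets[of k] by auto
  then show "real_polynomial_function (\<lambda>X. minors X $ k)"
    by (simp add: minors_def real_polynomial_function_minor)
qed

lemma lifted_sos_polyconvex_imp_sos_polyconvex:
  fixes f :: "real ^ 'n::{finite,linorder} ^ 'm::{finite,linorder} \<Rightarrow> real"
  assumes "lifted_sos_polyconvex f"
  shows "sos_polyconvex f"
proof -
  obtain g where g: "sos_convex g" "f = g \<circ> minors"
    using assms unfolding lifted_sos_polyconvex_def by blast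
  \<comment> \<open>Polynomiality of the substitution taking \<open>(X, Y)\<close> to
    \<open>(minors X, minors Y)\<close>.\<close>
  note p = polynomial_function_Pair
    [OF polynomial_function_compose[OF polynomial_function_bounded_linear[OF bounded_linear_fst] polynomial_function_minors]
        polynomial_function_compose[OF polynomial_function_bounded_linear[OF bounded_linear_snd] polynomial_function_minors]]
  have "sos (\<lambda>(X, Y). f X - f Y - (gradient g \<circ> minors) Y \<bullet> (minors X - minors Y))"
    using sos_compose[OF sos_convex_first_order[OF g(1)] p] by (simp add: g(2) case_prod_unfold)
  moreover have "polynomial_function (gradient g \<circ> minors :: real ^ 'n::{finite,linorder} ^ 'm::{finite,linorder} \<Rightarrow> _)"
    using g(1) by (intro polynomial_function_compose polynomial_function_minors polynomial_function_gradient)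
      (simp add: sos_convex_def)
  ultimately show ?thesis
    unfolding sos_polyconvex_def by blast
qed

lemma convex_extended_SUP_affine:
  fixes a :: "'i \<Rightarrow> real" and b :: "'i \<Rightarrow> 'a::real_inner"
  shows "convex_extended (\<lambda>x. SUP i. ereal (a i + b i \<bullet> x))"
proof -
  let ?g = "\<lambda>x. SUP i. ereal (a i + b i \<bullet> x)"
  have le: "ereal (a i + b i \<bullet> x) \<le> ?g x" for i x
    by (rule SUP_upper) simp
  \<comment> \<open>The index type is inhabited, so a finite affine value bounds the supremum from
    below.\<close>
  have "?g x \<noteq> - \<infinity>" for x
    using le[of undefined x] by auto
  moreover have "?g (u *\<^sub>R x + v *\<^sub>R y) \<le> ereal u * ?g x + ereal v * ?g y"
    if uv: "0 \<le> u" "0 \<le> v" "u + v = 1" for x y u v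
  proof (rule SUP_least)
    fix i
    \<comment> \<open>Since \<open>u + v = 1\<close>, the constant term also splits, and the affine
      function respects the convex combination exactly.\<close>
    have "a i + b i \<bullet> (u *\<^sub>R x + v *\<^sub>R y) = (u + v) * a i + b i \<bullet> (u *\<^sub>R x + v *\<^sub>R y)"
      by (simp add: uv(3))
    also have "\<dots> = u * (a i + b i \<bullet> x) + v * (a i + b i \<bullet> y)"
      by (simp add: inner_add_right algebra_simps)
    finally have "ereal (a i + b i \<bullet> (u *\<^sub>R x + v *\<^sub>R y))
        = ereal u * ereal (a i + b i \<bullet> x) + ereal v * ereal (a i + b i \<bullet> y)"
      by simp
    also have "\<dots> \<le> ereal u * ?g x + ereal v * ?g y"
      using uv by (intro add_mono ereal_mult_left_mono le) auto
    finally show "ereal (a i + b i \<bullet> (u *\<^sub>R x + v *\<^sub>R y)) \<le> ereal u * ?g x + ereal v * ?g y" .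
  qed
  ultimately show ?thesis
    unfolding convex_extended_def by blast
qed

text \<open>A sum of squares is nonnegative, so each \<open>Y\<close> supplies an affine minorant of
  \<open>f\<close> in the minors, exact at \<open>Y\<close>. Away from matrices of minors the
  supremum may be infinite, which extended values permit.\<close>

lemma sos_polyconvex_imp_polyconvex:
  fixes f :: "real ^ 'n::{finite,linorder} ^ 'm::{finite,linorder} \<Rightarrow> real"
  assumes "sos_polyconvex f"
  shows "polyconvex (\<lambda>X. ereal (f X))"
proof -
  obtain q where q: "sos (\<lambda>(X, Y). f X - f Y - q Y \<bullet> (minors X - minors Y))"
    using assms unfolding sos_polyconvex_def by blast
  define g where "g x = (SUP Y. ereal (f Y - q Y \<bullet> minors Y + q Y \<bullet> x))" for x
  have "ereal (f X) = g (minors X)" for X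
  proof (rule antisym)
    show "ereal (f X) \<le> g (minors X)"
      \<comment> \<open>The affine function attached to \<open>X\<close> itself takes the value
        \<open>f X\<close> at \<open>minors X\<close>.\<close>
      unfolding g_def by (rule SUP_upper2[of X]) auto
    have "f Y - q Y \<bullet> minors Y + q Y \<bullet> minors X \<le> f X" for Y
      using sos_nonneg[OF q, of "(X, Y)"] by (simp add: inner_diff_right)
    then show "g (minors X) \<le> ereal (f X)"
      unfolding g_def by (intro SUP_least) simp
  qed
  moreover have "convex_extended g"
    unfolding g_def by (rule convex_extended_SUP_affine)
  ultimately show ?thesis
    unfolding polyconvex_def by (intro exI[of _ g]) (simp add: fun_eq_iff)
qed

theorem theorem2p2:
  fixes f :: "real ^ 'n::{finite,linorder} ^ 'm::{finite,linorder} \<Rightarrow> real"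
  assumes "real_polynomial_function f"
  shows "(lifted_sos_polyconvex f \<longrightarrow> sos_polyconvex f) \<and>
         (sos_polyconvex f \<longrightarrow> polyconvex (\<lambda>X. ereal (f X)))"
  by (simp add: lifted_sos_polyconvex_imp_sos_polyconvex sos_polyconvex_imp_polyconvex)

end
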